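(* Let $0<\alpha<1$. There exist $C_1(\alpha)>0$ and $N(\alpha)$ such that for every integer $n\ge N(\alpha)$, $n\ge3$, and every even $j$ with $1\le j\le n$, $$\left|\lambda_{\alpha,n,j}-\lambda^{\operatorname{asympt}}_{\alpha,n,j}\right|\le\frac{C_1(\alpha)}{n^3}.$$
   Context: For an integer $n\ge3$ and a real number $\alpha$, $L_{\alpha,n}$ is the real symmetric $n\times n$ matrix with entries: $(L_{\alpha,n})_{1,1}=(L_{\alpha,n})_{n,n}=1+\alpha$; $(L_{\alpha,n})_{k,k}=2$ for $2\le k\le n-1$; $(L_{\alpha,n})_{k,k+1}=(L_{\alpha,n})_{k+1,k}=-1$ for $1\le k\le n-1$; $(L_{\alpha,n})_{1,n}=(L_{\alpha,n})_{n,1}=-\alpha$; all other entries are $0$. Its eigenvalues, counted with multiplicity, are $\lambda_{\alpha,n,1}\le\dots\le\lambda_{\alpha,n,n}$. Let $g(x)=2-2\cos x=4\sin^2(x/2)$, $d_{n,j}=\frac{(j-1)\pi}{n}$, $\varkappa_\alpha=\frac{\alpha}{1-\alpha}$. The function $\eta_\alpha\colon[0,\pi]\to\mathbb{R}$ is $\eta_\alpha(x)=2\arctan\left(\varkappa_\alpha\cot\frac{x}{2}\right)$ for $0<x\le\pi$, with $\eta_\alpha(0)=\pi$. Define $\Lambda_{\alpha,n}\colon[0,\pi]\to\mathbb{R}$ by $$\Lambda_{\alpha,n}(x)=g(x)+\frac{g'(x)\eta_\alpha(x)}{n}+\frac{g'(x)\eta_\alpha(x)\eta_\alpha'(x)+\frac12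 g''(x)\eta_\alpha(x)^2}{n^2},$$ and, for $j$ even with $1\le j\le n$, $\lambda^{\operatorname{asympt}}_{\alpha,n,j}=\Lambda_{\alpha,n}(d_{n,j})$. *)

theory Defs
  imports "HOL-Analysis.Analysis" "Jordan_Normal_Form.Char_Poly"
begin

(* Matrix indices start at 0: the entry at position (i, k) is (L_{alpha,n})_{i+1,k+1}.
   For n \<ge> 3 the cases do not overlap. *)
definition L_mat :: "real \<Rightarrow> nat \<Rightarrow> real Matrix.mat" where
  "L_mat \<alpha> n = Matrix.mat n n (\<lambda>(i, k).
     if i = k then (if i = 0 \<or> i = n - 1 then 1 + \<alpha> else 2)
     else if k = i + 1 \<or> i = k + 1 then - 1
     else if (i = 0 \<and> k = n - 1) \<or> (i = n - 1 \<and> k = 0) then - \<alpha>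
     else 0)"

(* The multiset proots contains the real roots of the characteristic polynomial with their
   algebraic multiplicities; for a real symmetric matrix these are all n eigenvalues.
   The index j runs over 1, ..., n, in increasing order of the eigenvalues. *)
definition eigval :: "real Matrix.mat \<Rightarrow> nat \<Rightarrow> real" where
  "eigval A j = sorted_list_of_multiset (proots (char_poly A)) ! (j - 1)"

definition g_fun :: "real \<Rightarrow> real" where
  "g_fun x = 2 - 2 * cos x"

definition d_pt :: "nat \<Rightarrow> nat \<Rightarrow> real" where
  "d_pt n j = (real j - 1) * pi / real n"

definition kappa :: "real \<Rightarrow> real" where
  "kappa \<alpha> = \<alpha> / (1 - \<alpha>)"

(* Only the values on {0..pi} are meaningful. *)
definition eta :: "real \<Rightarrow> real \<Rightarrow> real" where
  "eta \<alpha> x = (if x = 0 then pi else 2 * arctan (kappa \<alpha> * cot (x / 2)))"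

(* Derivative of eta as a function on {0..pi}, hence one-sided at the end points. *)
definition eta' :: "real \<Rightarrow> real \<Rightarrow> real" where
  "eta' \<alpha> x = vector_derivative (eta \<alpha>) (at x within {0..pi})"

definition Lambda :: "real \<Rightarrow> nat \<Rightarrow> real \<Rightarrow> real" where
  "Lambda \<alpha> n x = g_fun x + deriv g_fun x * eta \<alpha> x / real n
     + (deriv g_fun x * eta \<alpha> x * eta' \<alpha> x
        + 1 / 2 * deriv (deriv g_fun) x * (eta \<alpha> x)\<^sup>2) / (real n)\<^sup>2"

(* The asymptotic value for even j. *)
definition eigval_asympt :: "real \<Rightarrow> nat \<Rightarrow> nat \<Rightarrow> real" where
  "eigval_asympt \<alpha> n j = Lambda \<alpha> n (d_pt n j)"

end

theory Submission
  imports Defs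
begin

text \<open>
  Eigenvectors that are symmetric under reversal of the indices do not see the edge of weight
  \<open>\<alpha>\<close>; they give the eigenvalues \<open>g (d\<^sub>n\<^sub>,\<^sub>j)\<close> with \<open>j\<close> odd. The antisymmetric ones
  are sampled sines, and the boundary condition on their frequency \<open>x\<close> reads
  \<open>n x = (j - 1) \<pi> + \<eta> x\<close> with \<open>j\<close> even. Since \<open>0 \<le> \<eta> < \<pi>\<close>, this has a solution between
  \<open>d\<^sub>n\<^sub>,\<^sub>j\<close> and \<open>d\<^sub>n\<^sub>,\<^sub>j\<^sub>+\<^sub>1\<close>. The two families interlace, so together they provide \<open>n\<close>
  distinct roots of the characteristic polynomial, already in increasing order. The asymptotic
  formula is the second order Taylor expansion of \<open>g x\<close> at \<open>d\<^sub>n\<^sub>,\<^sub>j\<close>, where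
  \<open>x = d\<^sub>n\<^sub>,\<^sub>j + \<eta> x / n\<close> is iterated once; the error is uniform because \<open>\<eta>'\<close> is bounded and
  Lipschitz.
\<close>

section \<open>Eigenvectors sampled from solutions of the three-term recurrence\<close>

text \<open>The values of \<open>f\<close> at -1 and \<open>n\<close> act as ghost entries:
  \<open>left\<close> and \<open>right\<close> are exactly what turns the two perturbed corner rows
  into the recurrence that the inner rows already satisfy. The samples at 0, ..., n - 1 then form an
  eigenvector, and \<open>nz\<close> keeps it from vanishing.\<close>

lemma L_mat_root:
  fixes f :: "real \<Rightarrow> real"
  assumes n: "3 \<le> n"
    and rec: "\<And>y. f (y - 1) + f (y + 1) = 2 * cos x * f y"
    and left: "f (-1) = (1 - \<alpha>) * f 0 + \<alpha> * f (real n - 1)"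
    and right: "f (real n) = (1 - \<alpha>) * f (real n - 1) + \<alpha> * f 0"
    and nz: "f 0 \<noteq> 0"
  shows "poly (char_poly (L_mat \<alpha> n)) (g_fun x) = 0"
proof -
  define A where "A = L_mat \<alpha> n"
  define v where "v = Matrix.vec n (\<lambda>i. f (real i))"
  have A: "A \<in> carrier_mat n n" by (simp add: A_def L_mat_def)
  have row_sum: "(\<Sum>k = 0..<n. A $$ (i, k) * f (real k)) = g_fun x * f (real i)" if i: "i < n" for i
  proof -
    consider "i = 0" | "i = n - 1" | "0 < i" "i < n - 1" using i by linarith
    then show ?thesis
    proof cases
      case 1
      \<comment> \<open>A row has at most three nonzero entries; 3 \<le> n keeps their columns
        apart, so the sum splits into three delta sums.\<close>
      have "(\<Sum>k = 0..<n. A $$ (i, k) * f (real k)) =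
        (\<Sum>k = 0..<n. (if k = 0 then (1 + \<alpha>) * f 0 else 0) + (if k = 1 then - f 1 else 0)
           + (if k = n - 1 then - \<alpha> * f (real n - 1) else 0))"
        using 1 n by (intro sum.cong refl) (auto simp: A_def L_mat_def of_nat_diff)
      also have "\<dots> = (1 + \<alpha>) * f 0 - f 1 - \<alpha> * f (real n - 1)"
        using n by (simp add: sum.distrib)
      also have "\<dots> = g_fun x * f 0"
        using rec[of 0] left by (simp add: g_fun_def algebra_simps)
      finally show ?thesis using 1 by simp
    next
      case 2
      have "(\<Sum>k = 0..<n. A $$ (i, k) * f (real k)) =
        (\<Sum>k = 0..<n. (if k = n - 1 then (1 + \<alpha>) * f (real n - 1) else 0)
           + (if k = n - 2 then - f (real n - 2) else 0) + (if k = 0 then - \<alpha> * f 0 else 0))"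
        using 2 n by (intro sum.cong refl) (auto simp: A_def L_mat_def of_nat_diff)
      also have "\<dots> = (1 + \<alpha>) * f (real n - 1) - f (real n - 2) - \<alpha> * f 0"
        using n by (simp add: sum.distrib)
      also have "\<dots> = g_fun x * f (real n - 1)"
        using rec[of "real n - 1"] right by (simp add: g_fun_def algebra_simps)
      finally show ?thesis using 2 n by (simp add: of_nat_diff)
    next
      case 3
      have "(\<Sum>k = 0..<n. A $$ (i, k) * f (real k)) =
        (\<Sum>k = 0..<n. (if k = i then 2 * f (real i) else 0)
           + (if k = i - 1 then - f (real i - 1) else 0) + (if k = i + 1 then - f (real i + 1) else 0))"
        using 3 n by (intro sum.cong refl) (auto simp: A_def L_mat_def of_nat_diff add.commute)
      also have "\<dots> = 2 * f (real i) - f (real i - 1) - f (real i + 1)"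
        using 3 i less_imp_diff_less[OF i] by (simp add: sum.distrib)
      also have "\<dots> = g_fun x * f (real i)"
        using rec[of "real i"] by (simp add: g_fun_def algebra_simps)
      finally show ?thesis .
    qed
  qed
  have "A *\<^sub>v v = g_fun x \<cdot>\<^sub>v v"
    using A row_sum by (intro eq_vecI) (auto simp: v_def scalar_prod_def)
  moreover have "v \<noteq> 0\<^sub>v n"
  proof
    assume "v = 0\<^sub>v n"
    then have "vec_index v 0 = vec_index (0\<^sub>v n) 0" by simp
    with n nz show False by (simp add: v_def)
  qed
  ultimately have "eigenvalue A (g_fun x)"
    using A unfolding eigenvalue_def eigenvector_def by (intro exI[of _ v]) (auto simp: v_def)
  then show ?thesis using eigenvalue_root_char_poly[OF A] by (simp add: A_def)
qed

lemma L_mat_root_symmetric: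
  assumes n: "3 \<le> n" and m: "2 * m < n"
  shows "poly (char_poly (L_mat \<alpha> n)) (g_fun (2 * real m * pi / real n)) = 0"
proof -
  define x where "x = 2 * real m * pi / real n"
  have nx: "real n * x = 2 * real m * pi" using n by (simp add: x_def)
  have "real (2 * m) < real n" using m by (simp only: of_nat_less_iff)
  then have "2 * real m * pi < real n * pi" by simp
  then have x: "0 \<le> x" "x < pi" using n by (auto simp: x_def field_simps)
  \<comment> \<open>This cosine is even about -1/2 and has period \<open>n\<close>, so its values at
    -1, 0, n - 1 and n coincide, and both boundary conditions hold for every \<alpha>.\<close>
  define f where "f y = cos (y * x + x / 2)" for y
  have wrap: "cos (a + real n * x) = cos a" for a
    by (simp add: nx cos_add)
  have "poly (char_poly (L_mat \<alpha> n)) (g_fun x) = 0"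
  proof (rule L_mat_root[OF n, of f])
    show "f (y - 1) + f (y + 1) = 2 * cos x * f y" for y
      using cos_add[of "y * x + x / 2" x] cos_diff[of "y * x + x / 2" x]
      by (simp add: f_def algebra_simps)
    have a: "f (real n - 1) = f 0"
      using wrap[of "- (x / 2)"] by (simp add: f_def algebra_simps)
    have b: "f (- 1) = f 0"
      using cos_minus[of "x / 2"] by (simp add: f_def)
    have c: "f (real n) = f 0"
      using wrap[of "x / 2"] by (simp add: f_def algebra_simps)
    show "f (-1) = (1 - \<alpha>) * f 0 + \<alpha> * f (real n - 1)"
      "f (real n) = (1 - \<alpha>) * f (real n - 1) + \<alpha> * f 0"
      by (simp_all add: a b c algebra_simps)
    show "f 0 \<noteq> 0" using x cos_gt_zero_pi[of "x / 2"] by (simp add: f_def)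
  qed
  then show ?thesis by (simp add: x_def)
qed

text \<open>The sampled sine is odd about the midpoint (n - 1)/2. By this oddness the two boundary
  conditions say the same thing, and the addition theorems turn it into twice the equation
  \<open>eq\<close>.\<close>

lemma L_mat_root_antisymmetric:
  assumes n: "3 \<le> n" and x: "0 < x" "x < pi"
    and eq: "\<alpha> * sin (real n * x / 2) * cos (x / 2)
      + (1 - \<alpha>) * cos (real n * x / 2) * sin (x / 2) = 0"
  shows "poly (char_poly (L_mat \<alpha> n)) (g_fun x) = 0"
proof -
  define a where "a = real n * x / 2"
  define b where "b = x / 2"
  define f where "f y = sin (y * x + b - a)" for y
  have f0: "f 0 = sin (b - a)" by (simp add: f_def)
  have "-1 * x + b - a = - (a + b)" by (simp add: b_def)
  then have f1: "f (-1) = - sin (a + b)" by (metis f_def sin_minus)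
  have fn1: "f (real n - 1) = sin (a - b)" and fn: "f (real n) = sin (a + b)"
    by (simp_all add: f_def a_def b_def algebra_simps)
  have E: "\<alpha> * sin a * cos b + (1 - \<alpha>) * cos a * sin b = 0"
    using eq by (simp add: a_def b_def)
  have pos: "0 < cos b" "0 < sin b" using x by (auto simp: b_def intro!: cos_gt_zero_pi sin_gt_zero)
  show ?thesis
  proof (rule L_mat_root[OF n, of f])
    show "f (y - 1) + f (y + 1) = 2 * cos x * f y" for y
      using sin_add[of "y * x + b - a" x] sin_diff[of "y * x + b - a" x]
      by (simp add: f_def algebra_simps)
    show "f (-1) = (1 - \<alpha>) * f 0 + \<alpha> * f (real n - 1)"
      using E unfolding f0 f1 fn1 by (simp add: sin_add sin_diff algebra_simps)
    show "f (real n) = (1 - \<alpha>) * f (real n - 1) + \<alpha> * f 0"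
      using E unfolding f0 fn fn1 by (simp add: sin_add sin_diff algebra_simps)
    show "f 0 \<noteq> 0"
    proof
      \<comment> \<open>Then the two products in \<open>E\<close> are equal, and their weights
        \<alpha> and 1 - \<alpha> add up to 1; so both products vanish, which would force sin a =
        cos a = 0.\<close>
      assume "f 0 = 0"
      then have s: "sin a * cos b = cos a * sin b" by (simp add: f0 sin_diff algebra_simps)
      have "cos a * sin b = \<alpha> * (sin a * cos b) + (1 - \<alpha>) * (cos a * sin b)"
        unfolding s by (simp add: algebra_simps)
      then have "cos a * sin b = 0" using E by (simp only: mult.assoc)
      moreover from this s have "sin a * cos b = 0" by simp
      ultimately have "cos a = 0" "sin a = 0" using pos by auto
      then show False using sin_cos_squared_add[of a] by simp
    qed
  qed
qed

section \<open>Identifying the ordered list of roots\<close>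

text \<open>Distinct roots form a submultiset of \<open>proots p\<close>, whose size is at most the
  degree; with enough of them nothing else fits. That all roots are real and simple is thus a
  by-product of counting.\<close>

lemma sorted_list_of_proots:
  fixes p :: "real poly"
  assumes "p \<noteq> 0" and "degree p \<le> length ys" and "sorted_wrt (<) ys"
    and roots: "\<And>y. y \<in> set ys \<Longrightarrow> poly p y = 0"
  shows "sorted_list_of_multiset (proots p) = ys"
proof -
  have d: "distinct ys" and s: "sorted ys"
    using assms(3) by (simp_all add: strict_sorted_iff)
  have "mset ys \<subseteq># proots p"
  proof (rule mset_subset_eqI)
    fix y
    show "count (mset ys) y \<le> count (proots p) y"
    proof (cases "y \<in> set ys")
      case True
      then have "order y p \<noteq> 0" using roots assms(1) by (simp add: order_root)
      then show ?thesis using d True assms(1) by (simp add: distinct_count_atmost_1)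
    next
      case False
      then show ?thesis by (simp add: count_mset_0_iff[THEN iffD2])
    qed
  qed
  moreover have "size (proots p) \<le> size (mset ys)"
    using size_proots_le[of p] assms(2) by simp
  ultimately have "proots p = mset ys"
    by (metis leD mset_subset_size subset_mset.le_imp_less_or_eq)
  then show ?thesis using s by (simp add: sorted_list_of_multiset_mset sorted_sort_id)
qed

lemma g_fun_strict_mono: "\<lbrakk>0 \<le> x; x < y; y \<le> pi\<rbrakk> \<Longrightarrow> g_fun x < g_fun y"
  using cos_monotone_0_pi[of x y] by (simp add: g_fun_def)

section \<open>The phase function: bounds, derivative, Lipschitz estimate\<close>

text \<open>The derivative of \<open>eta\<close> with the cotangent cleared from the denominator.
  For \<open>kappa \<alpha>\<close> > 0 this form is smooth on the whole line, also at 0, which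
  makes uniform bounds possible.\<close>

definition eta_slope :: "real \<Rightarrow> real \<Rightarrow> real" where
  "eta_slope \<alpha> x = - kappa \<alpha> / ((sin (x / 2))\<^sup>2 + (kappa \<alpha>)\<^sup>2 * (cos (x / 2))\<^sup>2)"

text \<open>The strict upper bound, which fails at x = 0, later keeps each antisymmetric frequency
  strictly below the next grid point.\<close>

lemma eta_bounds:
  assumes "0 < \<alpha>" "\<alpha> < 1" "0 < x" "x \<le> pi"
  shows "0 \<le> eta \<alpha> x" "eta \<alpha> x < pi"
proof -
  have "0 \<le> cos (x / 2)" "0 < sin (x / 2)"
    using assms by (auto intro!: cos_ge_zero sin_gt_zero)
  then have "0 \<le> kappa \<alpha> * cot (x / 2)"
    using assms by (simp add: cot_def kappa_def)
  then show "0 \<le> eta \<alpha> x" using assms by (simp add: eta_def)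
  show "eta \<alpha> x < pi" using assms arctan_ubound[of "kappa \<alpha> * cot (x / 2)"] by (simp add: eta_def)
qed

lemma eta_denominator_ge:
  fixes k t :: real
  shows "min 1 (k\<^sup>2) \<le> (sin t)\<^sup>2 + k\<^sup>2 * (cos t)\<^sup>2"
proof -
  have "min 1 (k\<^sup>2) = min 1 (k\<^sup>2) * (sin t)\<^sup>2 + min 1 (k\<^sup>2) * (cos t)\<^sup>2"
    using sin_cos_squared_add[of t] by (metis distrib_left mult.right_neutral)
  also have "\<dots> \<le> 1 * (sin t)\<^sup>2 + k\<^sup>2 * (cos t)\<^sup>2"
    by (intro add_mono mult_right_mono) auto
  finally show ?thesis by simp
qed

lemma eta_has_derivative:
  assumes "0 < \<alpha>" "\<alpha> < 1" "0 < x" "x \<le> pi"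
  shows "(eta \<alpha> has_real_derivative eta_slope \<alpha> x) (at x)"
proof -
  define k where "k = kappa \<alpha>"
  have s: "0 < sin (x / 2)" using assms by (auto intro!: sin_gt_zero)
  have k: "0 < k" using assms by (simp add: k_def kappa_def)
  have "0 < min 1 (k\<^sup>2)" using k by simp
  then have D: "0 < (sin (x / 2))\<^sup>2 + k\<^sup>2 * (cos (x / 2))\<^sup>2"
    using eta_denominator_ge[of k "x / 2"] by linarith
  have "((\<lambda>x. cot (x / 2)) has_real_derivative - inverse ((sin (x / 2))\<^sup>2) * (1 / 2)) (at x)"
    using s by (intro DERIV_chain2[where f = cot and g = "\<lambda>x. x / 2"] DERIV_cot)
      (auto intro!: derivative_eq_intros)
  then have "((\<lambda>x. k * cot (x / 2)) has_real_derivative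
      k * (- inverse ((sin (x / 2))\<^sup>2) * (1 / 2))) (at x)"
    by (rule DERIV_cmult)
  then have "((\<lambda>x. arctan (k * cot (x / 2))) has_real_derivative
      inverse (1 + (k * cot (x / 2))\<^sup>2) * (k * (- inverse ((sin (x / 2))\<^sup>2) * (1 / 2)))) (at x)"
    by (rule DERIV_chain2[where f = arctan, OF DERIV_arctan])
  then have "((\<lambda>x. 2 * arctan (k * cot (x / 2))) has_real_derivative
      2 * (inverse (1 + (k * cot (x / 2))\<^sup>2) * (k * (- inverse ((sin (x / 2))\<^sup>2) * (1 / 2))))) (at x)"
    by (rule DERIV_cmult)
  also have "2 * (inverse (1 + (k * cot (x / 2))\<^sup>2) * (k * (- inverse ((sin (x / 2))\<^sup>2) * (1 / 2))))
      = eta_slope \<alpha> x"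
  proof -
    have eq: "1 + (k * cot (x / 2))\<^sup>2 =
        ((sin (x / 2))\<^sup>2 + k\<^sup>2 * (cos (x / 2))\<^sup>2) / (sin (x / 2))\<^sup>2"
      using s by (simp add: cot_def field_simps power_mult_distrib)
    have "2 * (inverse (Q / S) * (k * (- inverse S * (1 / 2)))) = - k / Q"
      if "0 < S" "0 < Q" for S Q :: real
      using that by (simp add: field_simps)
    from this[OF _ D] show ?thesis
      unfolding eq eta_slope_def k_def[symmetric] using s by simp
  qed
  finally show ?thesis
    \<comment> \<open>The arctan formula defines \<open>eta\<close> on all of the open half-line, so
      the derivative is two-sided even at pi.\<close>
    by (rule has_field_derivative_transform_within_open[of _ _ _ "{0<..}"])
       (use assms in \<open>auto simp: eta_def k_def\<close>)
qed

lemma eta'_eq: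
  assumes "0 < \<alpha>" "\<alpha> < 1" "0 < x" "x \<le> pi"
  shows "eta' \<alpha> x = eta_slope \<alpha> x"
  unfolding eta'_def
  using eta_has_derivative[OF assms, THEN has_field_derivative_at_within, of "{0..pi}"] assms
  by (intro vector_derivative_within_closed_interval)
     (auto simp: has_real_derivative_iff_has_vector_derivative)

lemma eta_slope_bound:
  assumes "0 < \<alpha>" "\<alpha> < 1"
  obtains M where "0 < M" "\<And>x. \<bar>eta_slope \<alpha> x\<bar> \<le> M"
    "\<And>x y. \<bar>eta_slope \<alpha> x - eta_slope \<alpha> y\<bar> \<le> M * \<bar>x - y\<bar>"
proof -
  define k where "k = kappa \<alpha>"
  define m where "m = min 1 (k\<^sup>2)"
  define q where "q t = (sin (t / 2))\<^sup>2 + k\<^sup>2 * (cos (t / 2))\<^sup>2" for t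
  define d where "d t = k * (1 - k\<^sup>2) * (sin (t / 2) * cos (t / 2)) / (q t)\<^sup>2" for t
  have k: "0 < k" using assms by (simp add: k_def kappa_def)
  have m: "0 < m" using k by (simp add: m_def)
  have q: "m \<le> q t" for t unfolding m_def q_def by (rule eta_denominator_ge)
  have qpos: "0 < q t" for t using q[of t] m by linarith
  have slope: "eta_slope \<alpha> = (\<lambda>t. - k / q t)"
    by (simp add: fun_eq_iff eta_slope_def q_def k_def)
  \<comment> \<open>The first summand bounds the slope, the second its derivative \<open>d\<close>;
    their sum serves for both estimates.\<close>
  define M where "M = k / m + k * \<bar>1 - k\<^sup>2\<bar> / m\<^sup>2"
  have b: "\<bar>eta_slope \<alpha> t\<bar> \<le> k / m" for t
    using k m q[of t] qpos[of t] by (simp add: slope frac_le)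
  have db: "\<bar>d t\<bar> \<le> M" for t
  proof -
    have "\<bar>sin (t / 2) * cos (t / 2)\<bar> \<le> 1 * 1"
      unfolding abs_mult by (intro mult_mono) auto
    then have "\<bar>d t\<bar> \<le> k * \<bar>1 - k\<^sup>2\<bar> * 1 / m\<^sup>2"
      unfolding d_def abs_mult abs_divide using k m q[of t]
      by (intro frac_le mult_mono) (auto simp: power_mono abs_mult)
    also have "\<dots> \<le> M" using k m by (simp add: M_def)
    finally show ?thesis .
  qed
  have der: "(eta_slope \<alpha> has_field_derivative d t) (at t)" for t
  proof -
    have "(q has_field_derivative (1 - k\<^sup>2) * (sin (t / 2) * cos (t / 2))) (at t)"
      unfolding q_def by (auto intro!: derivative_eq_intros simp: algebra_simps)
    from DERIV_divide[OF DERIV_const[of "- k"] this] qpos[of t]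
    show ?thesis by (simp add: slope d_def power2_eq_square mult.assoc)
  qed
  have "norm (eta_slope \<alpha> x - eta_slope \<alpha> y) \<le> M * norm (x - y)" for x y
    by (rule field_differentiable_bound[of UNIV _ d]) (auto simp: der db)
  moreover have "\<bar>eta_slope \<alpha> x\<bar> \<le> M" for x
    using b[of x] k m by (smt (verit) M_def divide_nonneg_nonneg mult_nonneg_nonneg zero_le_power2 abs_ge_zero)
  moreover have "0 < M" unfolding M_def using k m by (intro add_pos_nonneg) auto
  ultimately show ?thesis using that by auto
qed

text \<open>A single mean value point \<open>z\<close> yields both bounds: the size of the slope at
  \<open>z\<close> gives the first, its Lipschitz bound between \<open>z\<close> and
  \<open>d\<close> the second.\<close>

lemma eta_expansion:
  assumes "0 < \<alpha>" "\<alpha> < 1" "0 < d" "d \<le> x" "x \<le> pi"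
    and M: "0 < M" "\<And>x. \<bar>eta_slope \<alpha> x\<bar> \<le> M"
    "\<And>x y. \<bar>eta_slope \<alpha> x - eta_slope \<alpha> y\<bar> \<le> M * \<bar>x - y\<bar>"
  shows "\<bar>eta \<alpha> x - eta \<alpha> d\<bar> \<le> M * (x - d)"
    and "\<bar>eta \<alpha> x - eta \<alpha> d - eta_slope \<alpha> d * (x - d)\<bar> \<le> M * (x - d)\<^sup>2"
proof -
  obtain z where z: "d \<le> z" "z \<le> x" "eta \<alpha> x - eta \<alpha> d = (x - d) * eta_slope \<alpha> z"
  proof (cases "d = x")
    case False
    then have "d < x" using assms by simp
    from MVT2[OF this, of "eta \<alpha>" "eta_slope \<alpha>"] assms eta_has_derivative
    show ?thesis using that by (metis less_eq_real_def order_trans less_le_trans)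
  qed (use that in auto)
  show "\<bar>eta \<alpha> x - eta \<alpha> d\<bar> \<le> M * (x - d)"
    using z M(2)[of z] assms by (simp add: abs_mult mult_left_mono mult.commute[of M])
  have "eta \<alpha> x - eta \<alpha> d - eta_slope \<alpha> d * (x - d) = (x - d) * (eta_slope \<alpha> z - eta_slope \<alpha> d)"
    using z by (simp add: algebra_simps)
  also have "\<bar>\<dots>\<bar> \<le> (x - d) * (M * (x - d))"
  proof -
    have "\<bar>eta_slope \<alpha> z - eta_slope \<alpha> d\<bar> \<le> M * \<bar>z - d\<bar>" by (rule M)
    also have "\<dots> \<le> M * (x - d)" using z M by (intro mult_left_mono) auto
    finally show ?thesis using assms by (auto simp: abs_mult intro!: mult_left_mono)
  qed
  finally show "\<bar>eta \<alpha> x - eta \<alpha> d - eta_slope \<alpha> d * (x - d)\<bar> \<le> M * (x - d)\<^sup>2"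
    by (simp add: power2_eq_square mult_ac)
qed

section \<open>Taylor expansion of the eigenvalue function and the error of
  \<open>Lambda\<close>\<close>

text \<open>The addition theorem separates \<open>d\<close> from \<open>t\<close>, so the remainder
  is uniform in \<open>d\<close>: the sine and cosine remainders contribute at most a third of the
  cube of |t| each.\<close>

lemma g_fun_expansion:
  "\<bar>g_fun (d + t) - (g_fun d + 2 * sin d * t + cos d * t\<^sup>2)\<bar> \<le> \<bar>t\<bar> ^ 3"
proof -
  obtain s where s: "cos t = (\<Sum>m<3. cos_coeff m * t ^ m) + cos (s + 1/2 * real 3 * pi) / fact 3 * t ^ 3"
    using Maclaurin_cos_expansion[of t 3] by auto
  have "cos t - (1 - t\<^sup>2 / 2) = cos (s + 1/2 * real 3 * pi) * (t ^ 3 / 6)"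
    using s by (simp add: cos_coeff_def eval_nat_numeral fact_numeral)
  also have "\<bar>\<dots>\<bar> \<le> 1 * \<bar>t ^ 3 / 6\<bar>"
    unfolding abs_mult by (intro mult_right_mono) auto
  finally have c: "\<bar>cos t - (1 - t\<^sup>2 / 2)\<bar> \<le> \<bar>t\<bar> ^ 3 / 6" by (simp add: power_abs)
  have "\<bar>sin t - t\<bar> \<le> \<bar>t\<bar> ^ 3 / 6"
    using Maclaurin_sin_bound[of t 3] by (simp add: sin_coeff_def eval_nat_numeral fact_numeral)
  then have s': "\<bar>2 * sin d * (sin t - t)\<bar> \<le> 2 * 1 * (\<bar>t\<bar> ^ 3 / 6)"
    unfolding abs_mult by (intro mult_mono) auto
  have c': "\<bar>2 * cos d * (cos t - (1 - t\<^sup>2 / 2))\<bar> \<le> 2 * 1 * (\<bar>t\<bar> ^ 3 / 6)"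
    unfolding abs_mult using c by (intro mult_mono) auto
  have "g_fun (d + t) - (g_fun d + 2 * sin d * t + cos d * t\<^sup>2) =
      2 * sin d * (sin t - t) - 2 * cos d * (cos t - (1 - t\<^sup>2 / 2))"
    by (simp add: g_fun_def cos_add algebra_simps)
  moreover have "0 \<le> \<bar>t\<bar> ^ 3" by simp
  ultimately show ?thesis using s' c' by linarith
qed

lemma Lambda_eq:
  "Lambda \<alpha> n x = g_fun x + 2 * sin x * eta \<alpha> x / real n
     + (2 * sin x * eta \<alpha> x * eta' \<alpha> x + cos x * (eta \<alpha> x)\<^sup>2) / (real n)\<^sup>2"
proof -
  have 1: "deriv g_fun = (\<lambda>x. 2 * sin x)"
    unfolding g_fun_def by (rule ext, rule DERIV_imp_deriv) (auto intro!: derivative_eq_intros)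
  have 2: "deriv (\<lambda>x. 2 * sin x) = (\<lambda>x::real. 2 * cos x)"
    by (rule ext, rule DERIV_imp_deriv) (auto intro!: derivative_eq_intros)
  show ?thesis by (simp add: Lambda_def 1 2)
qed

lemma Lambda_error:
  assumes "0 < \<alpha>" "\<alpha> < 1" "0 < n" "0 < d" "d \<le> x" "x \<le> pi"
    and x: "x = d + eta \<alpha> x / real n"
    and M: "0 < M" "\<And>x. \<bar>eta_slope \<alpha> x\<bar> \<le> M"
    "\<And>x y. \<bar>eta_slope \<alpha> x - eta_slope \<alpha> y\<bar> \<le> M * \<bar>x - y\<bar>"
  shows "\<bar>g_fun x - Lambda \<alpha> n d\<bar> \<le> (64 + 64 * M + 8 * M\<^sup>2) / real n ^ 3"
proof -
  define N where "N = real n"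
  define t where "t = x - d"
  define e where "e = eta \<alpha> d"
  define E where "E = eta \<alpha> x"
  define s where "s = eta_slope \<alpha> d"
  have N: "0 < N" using assms by (simp add: N_def)
  have e: "0 \<le> e" "e \<le> 4" and E: "0 \<le> E" "E \<le> 4"
    using eta_bounds[of \<alpha> d] eta_bounds[of \<alpha> x] assms pi_less_4 by (auto simp: e_def E_def)
  have tE: "t = E / N" using x by (simp add: t_def E_def N_def)
  \<comment> \<open>The crude bound pi < 4 on \<open>eta\<close> is the source of the integer
    constants below.\<close>
  have t: "0 \<le> t" "t \<le> 4 / N" using tE E N by (auto simp: divide_right_mono)
  have s: "\<bar>s\<bar> \<le> M" by (simp add: s_def M)
  have Ee: "\<bar>E - e\<bar> \<le> M * t" and Es: "\<bar>E - e - s * t\<bar> \<le> M * t\<^sup>2"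
    using eta_expansion[OF assms(1,2,4,5,6) M] by (simp_all add: E_def e_def s_def t_def)
  have Ee': "\<bar>E - e\<bar> \<le> M * (4 / N)"
    using Ee mult_left_mono[OF t(2), of M] M by linarith
  have t2: "t\<^sup>2 \<le> (4 / N)\<^sup>2" and t3: "t ^ 3 \<le> (4 / N) ^ 3" using t by (auto intro: power_mono)
  have Es': "\<bar>E - e - s * t\<bar> \<le> M * (4 / N)\<^sup>2"
    using Es mult_left_mono[OF t2, of M] M by linarith
  \<comment> \<open>Since t = E / N, the error has two sources: the linearization of
    \<open>eta\<close> at \<open>d\<close>, and the replacement of \<open>E\<close> by
    \<open>e\<close> in the correction s * t.\<close>
  have R1: "\<bar>t - e / N - e * s / N\<^sup>2\<bar> \<le> (16 * M + 4 * M\<^sup>2) / N ^ 3"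
  proof -
    have "t - e / N - e * s / N\<^sup>2 = (E - e - s * t) / N + s * (E - e) / N\<^sup>2"
      using N by (simp add: tE field_simps power2_eq_square)
    also have "\<bar>\<dots>\<bar> \<le> \<bar>E - e - s * t\<bar> / N + \<bar>s\<bar> * \<bar>E - e\<bar> / N\<^sup>2"
      using N abs_triangle_ineq[of "(E - e - s * t) / N" "s * (E - e) / N\<^sup>2"]
      by (simp add: abs_mult abs_divide)
    also have "\<dots> \<le> M * (4 / N)\<^sup>2 / N + M * (M * (4 / N)) / N\<^sup>2"
      using N M s Ee' Es' by (intro add_mono divide_right_mono mult_mono) auto
    also have "\<dots> = (16 * M + 4 * M\<^sup>2) / N ^ 3"
      using N by (simp add: field_simps eval_nat_numeral)
    finally show ?thesis .
  qed
  have R2: "\<bar>t\<^sup>2 - e\<^sup>2 / N\<^sup>2\<bar> \<le> 32 * M / N ^ 3"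
  proof -
    have "t\<^sup>2 - e\<^sup>2 / N\<^sup>2 = (E - e) * (E + e) / N\<^sup>2"
      using N by (simp add: tE field_simps power2_eq_square)
    also have "\<bar>\<dots>\<bar> = \<bar>E - e\<bar> * (E + e) / N\<^sup>2"
      using e E by (simp add: abs_mult abs_divide)
    also have "\<dots> \<le> M * (4 / N) * 8 / N\<^sup>2"
      using N M e E Ee' by (intro divide_right_mono mult_mono) auto
    also have "\<dots> = 32 * M / N ^ 3"
      using N by (simp add: field_simps eval_nat_numeral)
    finally show ?thesis .
  qed
  have R3: "\<bar>g_fun x - (g_fun d + 2 * sin d * t + cos d * t\<^sup>2)\<bar> \<le> 64 / N ^ 3"
    using g_fun_expansion[of d t] t3 t(1) by (simp add: t_def power_divide)
  have S1: "\<bar>2 * sin d * (t - e / N - e * s / N\<^sup>2)\<bar> \<le> 2 * 1 * ((16 * M + 4 * M\<^sup>2) / N ^ 3)"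
    unfolding abs_mult[of "2 * sin d"] using R1 by (intro mult_mono) (auto simp: abs_mult)
  have S2: "\<bar>cos d * (t\<^sup>2 - e\<^sup>2 / N\<^sup>2)\<bar> \<le> 1 * (32 * M / N ^ 3)"
    unfolding abs_mult[of "cos d"] using R2 by (intro mult_mono) auto
  have "g_fun x - Lambda \<alpha> n d = (g_fun x - (g_fun d + 2 * sin d * t + cos d * t\<^sup>2))
      + 2 * sin d * (t - e / N - e * s / N\<^sup>2) + cos d * (t\<^sup>2 - e\<^sup>2 / N\<^sup>2)"
    using assms by (simp add: Lambda_eq eta'_eq e_def s_def N_def algebra_simps add_divide_distrib)
  \<comment> \<open>The three terms are the cubic Taylor remainder, the error in \<open>t\<close>
    and the error in its square.\<close>
  also have "\<bar>\<dots>\<bar> \<le> 64 / N ^ 3 + 2 * 1 * ((16 * M + 4 * M\<^sup>2) / N ^ 3) + 1 * (32 * M / N ^ 3)"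
    using R3 S1 S2 by linarith
  also have "\<dots> = (64 + 64 * M + 8 * M\<^sup>2) / N ^ 3"
    by (simp add: add_divide_distrib algebra_simps)
  finally show ?thesis by (simp add: N_def)
qed

section \<open>Antisymmetric frequencies and the ordering of the eigenvalues\<close>

text \<open>For j = 2m, halving the phase equation leaves a shift of m pi - pi/2, which swaps sine
  and cosine up to the common sign (-1)^m. What remains is tan u = \<open>kappa \<alpha>\<close> cot
  (x/2), the definition of u = \<open>eta\<close> / 2.\<close>

lemma antisymmetric_equation:
  assumes "0 < \<alpha>" "\<alpha> < 1" "0 < x" "x < pi" "even j"
    and eq: "real n * x = (real j - 1) * pi + eta \<alpha> x"
  shows "\<alpha> * sin (real n * x / 2) * cos (x / 2)
      + (1 - \<alpha>) * cos (real n * x / 2) * sin (x / 2) = 0"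
proof -
  define u where "u = arctan (kappa \<alpha> * cot (x / 2))"
  obtain m where j: "j = 2 * m" using assms by blast
  have s: "sin (x / 2) \<noteq> 0" using assms sin_gt_zero[of "x / 2"] by auto
  have arg: "real n * x / 2 = (u - pi / 2) + real m * pi"
    using eq assms by (simp add: eta_def u_def j field_simps)
  have sm: "sin (real n * x / 2) = (-1) ^ m * - cos u"
    and cm: "cos (real n * x / 2) = (-1) ^ m * sin u"
    unfolding arg sin_add cos_add sin_diff cos_diff by simp_all
  have "sin u = kappa \<alpha> * cot (x / 2) * cos u"
    by (simp add: u_def sin_arctan cos_arctan)
  then have "(1 - \<alpha>) * sin u * sin (x / 2) = \<alpha> * cos u * cos (x / 2)"
    using s assms by (simp add: kappa_def cot_def)
  then have "(-1) ^ m * ((1 - \<alpha>) * sin u * sin (x / 2) - \<alpha> * cos u * cos (x / 2)) = 0"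
    by simp
  then show ?thesis unfolding sm cm by (simp only: algebra_simps)
qed

text \<open>Intermediate value theorem for n x - \<open>eta \<alpha> x\<close> between neighbouring
  grid points. The bound 2 \<le> j keeps the interval away from 0. Any solution will do, since the
  later root count fixes which eigenvalue it gives.\<close>

lemma antisymmetric_point:
  assumes "0 < \<alpha>" "\<alpha> < 1" "2 \<le> j" "j \<le> n"
  obtains x where "d_pt n j \<le> x" "x < d_pt n (Suc j)" "x = d_pt n j + eta \<alpha> x / real n"
proof -
  have n: "0 < real n" using assms by simp
  have d0: "0 < d_pt n j" using assms by (simp add: d_pt_def)
  have d1: "d_pt n (Suc j) \<le> pi" using assms by (simp add: d_pt_def field_simps)
  have d: "d_pt n j \<le> d_pt n (Suc j)" using n by (simp add: d_pt_def divide_right_mono)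
  have nd: "real n * d_pt n i = (real i - 1) * pi" for i using n by (simp add: d_pt_def)
  have "\<exists>x. d_pt n j \<le> x \<and> x \<le> d_pt n (Suc j) \<and> real n * x - eta \<alpha> x = (real j - 1) * pi"
  proof (rule IVT')
    show "real n * d_pt n j - eta \<alpha> (d_pt n j) \<le> (real j - 1) * pi"
      unfolding nd using eta_bounds[of \<alpha> "d_pt n j"] assms d0 d d1 by simp
    show "(real j - 1) * pi \<le> real n * d_pt n (Suc j) - eta \<alpha> (d_pt n (Suc j))"
      unfolding nd using eta_bounds[of \<alpha> "d_pt n (Suc j)"] assms d0 d d1 by (simp add: algebra_simps)
    have "isCont (eta \<alpha>) x" if "x \<in> {d_pt n j..d_pt n (Suc j)}" for x
      using that d0 d1 by (intro DERIV_isCont[OF eta_has_derivative] assms) auto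
    then have "continuous_on {d_pt n j..d_pt n (Suc j)} (eta \<alpha>)"
      by (intro continuous_at_imp_continuous_on) blast
    then show "continuous_on {d_pt n j..d_pt n (Suc j)} (\<lambda>x. real n * x - eta \<alpha> x)"
      by (intro continuous_intros)
  qed (rule d)
  then obtain x where x: "d_pt n j \<le> x" "x \<le> d_pt n (Suc j)"
    "real n * x - eta \<alpha> x = (real j - 1) * pi" by blast
  have "eta \<alpha> x < pi" using eta_bounds[of \<alpha> x] assms x d0 d1 by simp
  then have "real n * x < real n * d_pt n (Suc j)" using x unfolding nd by (simp add: algebra_simps)
  then have "x < d_pt n (Suc j)" using n by simp
  moreover have "x = d_pt n j + eta \<alpha> x / real n"
    using x n by (simp add: d_pt_def field_simps)
  ultimately show ?thesis using that x by blast
qed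

lemma eigval_even:
  assumes \<alpha>: "0 < \<alpha>" "\<alpha> < 1" and n: "3 \<le> n" and j: "even j" "1 \<le> j" "j \<le> n"
  obtains x where "d_pt n j \<le> x" "x < pi" "x = d_pt n j + eta \<alpha> x / real n"
    "eigval (L_mat \<alpha> n) j = g_fun x"
proof -
  \<comment> \<open>One frequency per half-open grid cell: the left end for odd \<open>i\<close>, a
    solution of the phase equation for even \<open>i\<close>. Disjointness of the cells makes the
    frequencies strictly increasing.\<close>
  define P where "P i x \<longleftrightarrow> d_pt n i \<le> x \<and> x < d_pt n (Suc i) \<and>
      (if even i then x = d_pt n i + eta \<alpha> x / real n else x = d_pt n i)" for i x
  have np: "0 < real n" using n by simp
  have "\<exists>x. P i x" if "1 \<le> i" "i \<le> n" for i
  proof (cases "even i")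
    case True
    then have "2 \<le> i" using that by (cases "i = 1") auto
    from antisymmetric_point[OF \<alpha> this that(2)] show ?thesis using True unfolding P_def by metis
  next
    case False
    then show ?thesis using np by (auto simp: P_def d_pt_def divide_strict_right_mono)
  qed
  then obtain X where X: "\<And>i. \<lbrakk>1 \<le> i; i \<le> n\<rbrakk> \<Longrightarrow> P i (X i)" by metis
  have d_mono: "d_pt n i \<le> d_pt n k" if "i \<le> k" for i k
    using that np by (simp add: d_pt_def divide_right_mono)
  have d_0: "d_pt n (Suc 0) = 0" by (simp add: d_pt_def)
  have X_ge: "0 \<le> X i" if "1 \<le> i" "i \<le> n" for i
    using X[OF that] d_mono[OF that(1)] d_0 by (simp add: P_def)
  \<comment> \<open>The \<open>n\<close> cells tile [0, pi), so all frequencies lie where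
    \<open>g_fun\<close> is strictly increasing.\<close>
  have "real (Suc n) - 1 = real n" by simp
  then have d_pi: "d_pt n (Suc n) = pi" unfolding d_pt_def using np by simp
  have X_less: "X i < pi" if "1 \<le> i" "i \<le> n" for i
    using X[OF that] d_mono[of "Suc i" "Suc n"] that d_pi by (simp add: P_def)
  define ys where "ys = map (\<lambda>i. g_fun (X i)) [1..<Suc n]"
  define p where "p = char_poly (L_mat \<alpha> n)"
  have A: "L_mat \<alpha> n \<in> carrier_mat n n" by (simp add: L_mat_def)
  have deg: "degree p = n" "p \<noteq> 0"
    using degree_monic_char_poly[OF A] by (auto simp: p_def)
  have root: "poly p (g_fun (X i)) = 0" if i: "1 \<le> i" "i \<le> n" for i
  proof (cases "even i")
    case True
    have eq: "real n * X i = (real i - 1) * pi + eta \<alpha> (X i)"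
      using X[OF i] True np by (simp add: P_def d_pt_def field_simps)
    have "0 < d_pt n i" using True i np by (cases "i = 1") (auto simp: d_pt_def)
    then have "0 < X i" using X[OF i] by (simp add: P_def)
    with X_less[OF i] show ?thesis unfolding p_def
      by (intro L_mat_root_antisymmetric n antisymmetric_equation[OF \<alpha> _ _ True eq])
  next
    case False
    then obtain m where m: "i = 2 * m + 1" by (rule oddE)
    have "X i = 2 * real m * pi / real n" using X[OF i] False by (simp add: P_def d_pt_def m)
    then show ?thesis unfolding p_def using L_mat_root_symmetric[OF n, of m \<alpha>] i m by simp
  qed
  have "sorted_list_of_multiset (proots p) = ys"
  proof (rule sorted_list_of_proots)
    have "X i < X k" if "1 \<le> i" "i < k" "k \<le> n" for i k
      using X[of i] X[of k] d_mono[of "Suc i" k] that by (simp add: P_def)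
    then have "g_fun (X i) < g_fun (X k)" if "1 \<le> i" "i < k" "k \<le> n" for i k
      using that X_ge[of i] X_less[of k] by (intro g_fun_strict_mono) auto
    then show "sorted_wrt (<) ys"
      by (auto simp: ys_def sorted_wrt_iff_nth_less simp del: upt_Suc)
  qed (use deg root in \<open>auto simp: ys_def simp del: upt_Suc\<close>)
  \<comment> \<open>The frequencies are numbered from 1 and list positions from 0; the j - 1 in
    \<open>eigval\<close> compensates for this.\<close>
  moreover have "[1..<Suc n] ! (j - 1) = j" using j by (subst nth_upt) auto
  ultimately have "eigval (L_mat \<alpha> n) j = g_fun (X j)"
    using j by (simp add: eigval_def p_def ys_def del: upt_Suc)
  with X[OF j(2,3)] X_less[OF j(2,3)] j(1) show ?thesis
    by (intro that[of "X j"]) (auto simp: P_def)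
qed

theorem theorem4:
  fixes \<alpha> :: real
  assumes "0 < \<alpha>" and "\<alpha> < 1"
  shows "\<exists>C1>0. \<exists>N::nat. \<forall>n::nat. n \<ge> N \<longrightarrow> n \<ge> 3 \<longrightarrow>
    (\<forall>j::nat. even j \<longrightarrow> 1 \<le> j \<longrightarrow> j \<le> n \<longrightarrow>
      \<bar>eigval (L_mat \<alpha> n) j - eigval_asympt \<alpha> n j\<bar> \<le> C1 / (real n) ^ 3)"
proof -
  obtain M where M: "0 < M" "\<And>x. \<bar>eta_slope \<alpha> x\<bar> \<le> M"
    "\<And>x y. \<bar>eta_slope \<alpha> x - eta_slope \<alpha> y\<bar> \<le> M * \<bar>x - y\<bar>"
    using eta_slope_bound[OF assms] by blast
  have "\<bar>eigval (L_mat \<alpha> n) j - eigval_asympt \<alpha> n j\<bar> \<le> (64 + 64 * M + 8 * M\<^sup>2) / real n ^ 3"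
    if n: "3 \<le> n" and j: "even j" "1 \<le> j" "j \<le> n" for n j
  proof -
    obtain x where x: "d_pt n j \<le> x" "x < pi" "x = d_pt n j + eta \<alpha> x / real n"
      "eigval (L_mat \<alpha> n) j = g_fun x"
      using eigval_even[OF assms n j] by blast
    \<comment> \<open>Evenness rules out j = 1, whose grid point 0 lies outside the range of the
      bounds and derivative formula for \<open>eta\<close>.\<close>
    have "0 < d_pt n j" using n j by (cases "j = 1") (auto simp: d_pt_def)
    with x n show ?thesis unfolding eigval_asympt_def x(4)
      by (intro Lambda_error[OF assms _ _ _ _ _ M]) auto
  qed
  moreover have "0 < 64 + 64 * M + 8 * M\<^sup>2" using M by (intro add_pos_nonneg) auto
  ultimately show ?thesis by blast
qed

end
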